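(* For integers $a,b\ge 1$ and $n\ge 0$, let $N_{a,b}(n)$ be the number of partitions $\lambda$ of $n$ with pairing index $T(\lambda)=a$ and pairing width $W(\lambda)=b$. Then for all $a,b\geq 1$, $$\sum_{n\geq0}N_{a,b}(n)q^n=q^{a+b-1}\genfrac{[}{]}{0pt}{}{a+b-2}{a-1}_{q}.$$
   Context: For an integer partition $\lambda$, pair equal parts of $\lambda$ as far as possible: for each part size occurring with odd multiplicity exactly one copy remains unpaired, and a part size of even multiplicity is completely paired. Let $r(\lambda)$ be the largest part size that participates in at least one pair (i.e. of multiplicity at least $2$), with $r(\lambda)=0$ if $\lambda$ has distinct parts. Write the unpaired parts (the part sizes of odd multiplicity, each once) in decreasing order $u_1>u_2>\cdots>u_j$ and let $s(\lambda)=u_1-u_2+u_3-u_4+\cdots$ (so $s(\lambda)=0$ if there are no unpaired parts). The pairing index of $\lambda$ is $T(\lambda)=r(\lambda)+s(\lambda)$. The pair span of $\lambda$ is the number of parts of $\lambda$ (counted with multiplicity) that belong to pairs. The residual span of $\lambda$ is $2\bigl(u_1-s(\lambda)\bigr)+1$ if there is at least one unpaired part, and $0$ if there are no unpaired parts. The pairing width $W(\lambda)$ is the larger of the pair span and the residual span. The Gaussian binomial coefficient is $\genfrac{[}{]}{0pt}{}{A}{B}_{q}=\frac{(q;q)_A}{(q;q)_B(q;q)_{A-B}}$ for $0\le B\le A$ and $0$ otherwise, where $(q;q)_N=\prod_{j=1}^{N}(1-q^j)$. *)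

theory Defs
  imports
    "HOL-Library.Multiset"
    "HOL-Computational_Algebra.Formal_Power_Series"
begin

definition partitions_of :: "nat \<Rightarrow> nat multiset set" where
  "partitions_of n = {p. 0 \<notin># p \<and> sum_mset p = n}"

lemma finite_partitions_of: "finite (partitions_of n)"
proof -
  have "partitions_of n \<subseteq> mset ` {xs. set xs \<subseteq> {..n} \<and> length xs \<le> n}"
  proof
    fix p assume p: "p \<in> partitions_of n"
    obtain xs where xs: "p = mset xs" by (metis ex_mset)
    have zero: "0 \<notin> set xs" and sum: "sum_list xs = n"
      using p by (auto simp: partitions_of_def xs sum_mset_sum_list)
    have "set xs \<subseteq> {..n}" using sum member_le_sum_list by fastforce
    moreover have "length xs \<le> sum_list xs" using zero by (induction xs) auto
    ultimately show "p \<in> mset ` {xs. set xs \<subseteq> {..n} \<and> length xs \<le> n}"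
      using sum xs by auto
  qed
  then show ?thesis
    by (rule finite_subset) (intro finite_imageI finite_lists_length_le finite_atMost)
qed

definition unpaired_sizes :: "nat multiset \<Rightarrow> nat set" where
  "unpaired_sizes p = {k. odd (count p k)}"

definition unpaired_list :: "nat multiset \<Rightarrow> nat list" where
  "unpaired_list p = rev (sorted_list_of_set (unpaired_sizes p))"

definition paired_parts :: "nat multiset \<Rightarrow> nat multiset" where
  "paired_parts p = p - mset_set (unpaired_sizes p)"

definition largest_paired :: "nat multiset \<Rightarrow> nat" where
  "largest_paired p =
     (if \<exists>k. count p k \<ge> 2 then Max {k. count p k \<ge> 2} else 0)"

text \<open>The list index starts at \<open>0\<close>, so \<open>unpaired_list p ! i\<close> is \<open>u\<^sub>i\<^sub>+\<^sub>1\<close>. The sum is taken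
  in \<open>int\<close> to avoid truncated subtraction.\<close>

definition unpaired_alternating_sum :: "nat multiset \<Rightarrow> int" where
  "unpaired_alternating_sum p =
     (\<Sum>i<length (unpaired_list p). (-1) ^ i * int (unpaired_list p ! i))"

definition pairing_index :: "nat multiset \<Rightarrow> int" where
  "pairing_index p = int (largest_paired p) + unpaired_alternating_sum p"

definition pair_span :: "nat multiset \<Rightarrow> nat" where
  "pair_span p = size (paired_parts p)"

definition residual_span :: "nat multiset \<Rightarrow> int" where
  "residual_span p =
     (if unpaired_list p = [] then 0
      else 2 * (int (hd (unpaired_list p)) - unpaired_alternating_sum p) + 1)"

definition pairing_width :: "nat multiset \<Rightarrow> int" where
  "pairing_width p = max (int (pair_span p)) (residual_span p)"

definition pairing_count :: "nat \<Rightarrow> nat \<Rightarrow> nat \<Rightarrow> nat" where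
  "pairing_count a b n =
     card {p \<in> partitions_of n. pairing_index p = int a \<and> pairing_width p = int b}"

definition qq_pochhammer :: "nat \<Rightarrow> rat fps" where
  "qq_pochhammer N = (\<Prod>j=1..N. 1 - fps_X ^ j)"

text \<open>The denominator has constant coefficient \<open>1\<close>, so this is an exact quotient of formal
  power series over a field.\<close>

definition gauss_binomial :: "nat \<Rightarrow> nat \<Rightarrow> rat fps" where
  "gauss_binomial A B =
     (if B \<le> A then qq_pochhammer A / (qq_pochhammer B * qq_pochhammer (A - B)) else 0)"

end

theory Submission
  imports Defs
begin

text \<open>Write a partition as \<open>P + P + U\<close> with \<open>U\<close> strict. The width is at most \<open>b \<ge> 1\<close> iff
  \<open>|P| \<le> b div 2\<close> and \<open>t \<le> (b - 1) div 2\<close>, where \<open>t = u\<^sub>1 - s(U)\<close> is the alternating sum of the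
  tail of \<open>U\<close>; so the partitions of index \<open>a\<close> and width at most \<open>b\<close> are counted by a convolution
  over \<open>r + s = a\<close>. Deleting \<open>u\<^sub>1\<close> gives a recursion which shows that strict partitions with
  alternating sum \<open>s\<close> and \<open>t \<le> c\<close> have generating function \<open>q^s [s + c, s]\<close> in base \<open>q\<^sup>2\<close>;
  the multisets \<open>P\<close> likewise give Gaussian binomials in base \<open>q\<^sup>2\<close>. Raising \<open>b\<close> by one changes only
  one of the two factors, and Pascal's rule in that factor yields
  \<open>K(a, b) = K(a, b - 1) + q^b K(a - 1, b)\<close> for the convolution \<open>K\<close>, hence
  \<open>K(a, b) = q^a [a + b - 1, a]\<close>. The partitions of width exactly \<open>b\<close> are counted by
  \<open>K(a, b) - K(a, b - 1) = q^b K(a - 1, b)\<close>.\<close>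

section \<open>Gaussian binomials by Pascal recursion\<close>

text \<open>\<open>qbin q i j\<close> stands for the Gaussian binomial with top \<open>i + j\<close> and bottom \<open>i\<close>.\<close>

fun qbin :: "'a::comm_ring_1 \<Rightarrow> nat \<Rightarrow> nat \<Rightarrow> 'a" where
  "qbin q 0 j = 1"
| "qbin q (Suc i) 0 = 1"
| "qbin q (Suc i) (Suc j) = qbin q i (Suc j) + q ^ Suc i * qbin q (Suc i) j"

lemma qbin_0_right [simp]: "qbin q i 0 = 1"
  by (cases i) auto

definition qpoch :: "'a::comm_ring_1 \<Rightarrow> nat \<Rightarrow> 'a" where
  "qpoch q n = (\<Prod>k=1..n. 1 - q ^ k)"

lemma qpoch_0 [simp]: "qpoch q 0 = 1"
  by (simp add: qpoch_def)

lemma qpoch_Suc: "qpoch q (Suc n) = qpoch q n * (1 - q ^ Suc n)"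
  by (simp add: qpoch_def)

text \<open>The product formula without division, by induction along the Pascal recursion:
  \<open>(1 - q ^ Suc i) + q ^ Suc i * (1 - q ^ Suc j)\<close> collapses to the next Pochhammer
  factor.\<close>

lemma qbin_mult_qpoch: "qbin q i j * qpoch q i * qpoch q j = qpoch q (i + j)"
proof (induction q i j rule: qbin.induct)
  case (3 q i j)
  have "qbin q (Suc i) (Suc j) * qpoch q (Suc i) * qpoch q (Suc j)
      = (qbin q i (Suc j) * qpoch q i * qpoch q (Suc j)) * (1 - q ^ Suc i)
        + q ^ Suc i * (qbin q (Suc i) j * qpoch q (Suc i) * qpoch q j) * (1 - q ^ Suc j)"
    by (simp add: qpoch_Suc algebra_simps del: power_Suc)
  also have "\<dots> = qpoch q (Suc (i + j)) * ((1 - q ^ Suc i) + q ^ Suc i * (1 - q ^ Suc j))"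
    using 3 by (simp add: algebra_simps del: power_Suc)
  also have "(1 - q ^ Suc i) + q ^ Suc i * (1 - q ^ Suc j) = 1 - q ^ Suc (Suc (i + j))"
    by (simp add: algebra_simps power_add)
  finally show ?case
    by (simp add: qpoch_Suc)
qed auto

context
  fixes q :: "'a::idom"
  assumes not_root_of_unity: "\<And>k. k > 0 \<Longrightarrow> q ^ k \<noteq> 1"
begin

lemma qpoch_nonzero: "qpoch q n \<noteq> 0"
  using not_root_of_unity by (force simp: qpoch_def)

text \<open>The product formula is symmetric in \<open>i\<close> and \<open>j\<close>, and its
  nonzero Pochhammer factors cancel.\<close>

lemma qbin_sym: "qbin q i j = qbin q j i"
proof -
  have "qbin q i j * (qpoch q i * qpoch q j) = qbin q j i * (qpoch q i * qpoch q j)"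
    using qbin_mult_qpoch[of q i j] qbin_mult_qpoch[of q j i]
    by (simp add: ac_simps)
  then show ?thesis
    using qpoch_nonzero by simp
qed

text \<open>The mirrored Pascal rule, with the power governed by \<open>j\<close>; the recursions in
  the size and width bounds have this form.\<close>

lemma qbin_Suc_Suc': "qbin q (Suc i) (Suc j) = qbin q (Suc i) j + q ^ Suc j * qbin q i (Suc j)"
  by (metis qbin.simps(3) qbin_sym)

end

lemma fps_X_power_neq_1:
  assumes "k > 0" shows "(fps_X :: 'a::comm_ring_1 fps) ^ k \<noteq> 1"
  by (metis assms fps_X_power_nth fps_one_nth less_irrefl zero_neq_one)

lemma qbin_fps_X_Suc_Suc':
  "qbin (fps_X :: rat fps) (Suc i) (Suc j) =
     qbin fps_X (Suc i) j + fps_X ^ Suc j * qbin fps_X i (Suc j)"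
  by (rule qbin_Suc_Suc') (rule fps_X_power_neq_1)

lemma fps_X2_power_neq_1: "k > 0 \<Longrightarrow> ((fps_X :: rat fps)\<^sup>2) ^ k \<noteq> 1"
  by (simp add: fps_X_power_neq_1 flip: power_mult)

lemma gauss_binomial_eq_qbin: "gauss_binomial (i + j) i = qbin fps_X i j"
proof -
  have poch: "qq_pochhammer n = qpoch fps_X n" for n
    by (simp add: qq_pochhammer_def qpoch_def)
  have nz: "qpoch (fps_X :: rat fps) n \<noteq> 0" for n
    by (rule qpoch_nonzero) (rule fps_X_power_neq_1)
  have "gauss_binomial (i + j) i =
      qbin fps_X i j * (qpoch fps_X i * qpoch fps_X j) / (qpoch fps_X i * qpoch fps_X j)"
    using qbin_mult_qpoch[of "fps_X :: rat fps" i j] by (simp add: gauss_binomial_def poch ac_simps)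
  also have "\<dots> = qbin fps_X i j"
    using nz by (intro nonzero_mult_div_cancel_right) simp
  finally show ?thesis .
qed

section \<open>Generating functions of weighted sets\<close>

text \<open>As \<open>card\<close> is 0 on infinite sets, the sum and product rules for
  \<open>gf\<close> rely on finite fibers.\<close>

definition finite_fibers :: "('a \<Rightarrow> nat) \<Rightarrow> 'a set \<Rightarrow> bool" where
  "finite_fibers w S \<longleftrightarrow> (\<forall>n. finite {x \<in> S. w x = n})"

definition gf :: "('a \<Rightarrow> nat) \<Rightarrow> 'a set \<Rightarrow> rat fps" where
  "gf w S = Abs_fps (\<lambda>n. of_nat (card {x \<in> S. w x = n}))"

lemma finite_fibers_subset: "finite_fibers w T \<Longrightarrow> S \<subseteq> T \<Longrightarrow> finite_fibers w S"
  unfolding finite_fibers_def by (fast elim: rev_finite_subset)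

lemma gf_empty [simp]: "gf w {} = 0"
  by (simp add: gf_def fps_eq_iff)

lemma gf_singleton: "gf w {x} = fps_X ^ w x"
proof -
  have "{y. y = x \<and> w y = n} = (if n = w x then {x} else {})" for n
    by auto
  then show ?thesis
    by (auto simp: gf_def fps_eq_iff)
qed

lemma gf_Un:
  assumes "finite_fibers w S" "finite_fibers w T" "S \<inter> T = {}"
  shows "gf w (S \<union> T) = gf w S + gf w T"
proof -
  have "card {x \<in> S \<union> T. w x = n} = card {x \<in> S. w x = n} + card {x \<in> T. w x = n}" for n
  proof -
    have "{x \<in> S \<union> T. w x = n} = {x \<in> S. w x = n} \<union> {x \<in> T. w x = n}"
      by auto
    then show ?thesis
      using assms by (auto simp: finite_fibers_def intro!: card_Un_disjoint)
  qed
  then show ?thesis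
    by (simp add: gf_def fps_eq_iff)
qed

lemma gf_UN:
  assumes "finite I" "\<And>i. i \<in> I \<Longrightarrow> finite_fibers w (S i)"
    "\<And>i j. i \<in> I \<Longrightarrow> j \<in> I \<Longrightarrow> i \<noteq> j \<Longrightarrow> S i \<inter> S j = {}"
  shows "gf w (\<Union>i\<in>I. S i) = (\<Sum>i\<in>I. gf w (S i))"
proof -
  have "card {x \<in> \<Union>i\<in>I. S i. w x = n} = (\<Sum>i\<in>I. card {x \<in> S i. w x = n})" for n
  proof -
    have "{x \<in> \<Union>i\<in>I. S i. w x = n} = (\<Union>i\<in>I. {x \<in> S i. w x = n})"
      by auto
    also have "card \<dots> = (\<Sum>i\<in>I. card {x \<in> S i. w x = n})"
    proof (rule card_UN_disjoint)
      show "\<forall>i\<in>I. finite {x \<in> S i. w x = n}"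
        using assms(2) by (simp add: finite_fibers_def)
      show "\<forall>i\<in>I. \<forall>j\<in>I. i \<noteq> j \<longrightarrow> {x \<in> S i. w x = n} \<inter> {x \<in> S j. w x = n} = {}"
        using assms(3) by blast
    qed (rule assms)
    finally show ?thesis .
  qed
  then show ?thesis
    by (simp add: gf_def fps_eq_iff fps_sum_nth)
qed

lemma gf_bij:
  assumes bij: "bij_betw f S T" and wt: "\<And>x. x \<in> S \<Longrightarrow> v (f x) = w x + k"
  shows "gf v T = fps_X ^ k * gf w S"
proof -
  have "card {y \<in> T. v y = n} = (if n < k then 0 else card {x \<in> S. w x = n - k})" for n
  proof (cases "n < k")
    case True
    have "v y \<noteq> n" if "y \<in> T" for y
      using that bij wt True by (fastforce simp: bij_betw_def)
    then have "{y \<in> T. v y = n} = {}"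
      by blast
    then show ?thesis
      using True by (simp only: card.empty if_True)
  next
    case False
    have "bij_betw f {x \<in> S. w x = n - k} {y \<in> T. v y = n}"
      using bij wt False unfolding bij_betw_def by (auto intro: inj_on_subset)
    then show ?thesis
      using False by (simp add: bij_betw_same_card)
  qed
  then show ?thesis
    by (simp add: gf_def fps_eq_iff fps_X_power_mult_nth)
qed

text \<open>Splitting by the weight of the first component gives the terms of the Cauchy
  product.\<close>

lemma fiber_Times:
  fixes w :: "'a \<Rightarrow> nat" and v :: "'b \<Rightarrow> nat"
  shows "{z \<in> S \<times> T. (case z of (x, y) \<Rightarrow> w x + v y) = n} =
     (\<Union>i\<in>{0..n}. {x \<in> S. w x = i} \<times> {y \<in> T. v y = n - i})"
  by auto

lemma finite_fibers_Times:
  assumes "finite_fibers w S" "finite_fibers v T"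
  shows "finite_fibers (\<lambda>(x, y). w x + v y) (S \<times> T)"
  unfolding finite_fibers_def fiber_Times using assms by (simp add: finite_fibers_def)

lemma gf_Times:
  assumes "finite_fibers w S" "finite_fibers v T"
  shows "gf (\<lambda>(x, y). w x + v y) (S \<times> T) = gf w S * gf v T"
proof -
  have "card {z \<in> S \<times> T. (case z of (x, y) \<Rightarrow> w x + v y) = n} =
      (\<Sum>i\<in>{0..n}. card {x \<in> S. w x = i} * card {y \<in> T. v y = n - i})" for n
    unfolding fiber_Times card_cartesian_product[symmetric]
    using assms by (intro card_UN_disjoint) (auto simp: finite_fibers_def)
  then show ?thesis
    by (simp add: gf_def fps_eq_iff fps_mult_nth)
qed

section \<open>Strictly decreasing lists and alternating sums\<close>

definition strict_parts :: "nat list \<Rightarrow> bool" where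
  "strict_parts xs \<longleftrightarrow> sorted_wrt (>) xs \<and> 0 \<notin> set xs"

text \<open>On strictly decreasing lists the subtraction never truncates.\<close>

fun altsum :: "nat list \<Rightarrow> nat" where
  "altsum [] = 0"
| "altsum (x # xs) = x - altsum xs"

lemma strict_parts_Nil [simp]: "strict_parts []"
  by (simp add: strict_parts_def)

lemma strict_parts_Cons:
  "strict_parts (x # xs) \<longleftrightarrow> x > 0 \<and> strict_parts xs \<and> (xs = [] \<or> hd xs < x)"
  by (cases xs) (auto simp: strict_parts_def)

lemma altsum_le_hd: "altsum xs \<le> hd xs" if "xs \<noteq> []"
  using that by (cases xs) auto

lemma altsum_less: "strict_parts (x # xs) \<Longrightarrow> altsum xs < x"
  using altsum_le_hd[of xs] by (cases "xs = []") (auto simp: strict_parts_Cons)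

lemma hd_eq_altsum: "strict_parts xs \<Longrightarrow> xs \<noteq> [] \<Longrightarrow> hd xs = altsum xs + altsum (tl xs)"
  using altsum_less[of "hd xs" "tl xs"] by (cases xs) auto

lemma altsum_eq_0_iff: "strict_parts xs \<Longrightarrow> altsum xs = 0 \<longleftrightarrow> xs = []"
  using altsum_less[of "hd xs" "tl xs"] by (cases xs) auto

lemma altsum_eq_sum:
  "strict_parts xs \<Longrightarrow> int (altsum xs) = (\<Sum>i<length xs. (- 1) ^ i * int (xs ! i))"
proof (induction xs)
  case (Cons x xs)
  then have "int (altsum (x # xs)) = int x - (\<Sum>i<length xs. (- 1) ^ i * int (xs ! i))"
    using altsum_less[of x xs] by (simp add: strict_parts_Cons of_nat_diff)
  also have "\<dots> = (\<Sum>i<length (x # xs). (- 1) ^ i * int ((x # xs) ! i))"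
    by (simp only: length_Cons sum.lessThan_Suc_shift) (simp add: sum_negf)
  finally show ?case .
qed simp

lemma finite_fibers_strict_parts: "finite_fibers sum_list {xs. strict_parts xs}"
  unfolding finite_fibers_def
proof
  fix n
  have "{xs. strict_parts xs \<and> sum_list xs = n} \<subseteq> {xs. set xs \<subseteq> {..n} \<and> length xs \<le> n}"
  proof clarify
    fix xs assume "strict_parts xs" and n: "n = sum_list xs"
    then have "0 \<notin> set xs"
      by (simp add: strict_parts_def)
    then have "length xs \<le> sum_list xs"
      by (induction xs) auto
    then show "set xs \<subseteq> {..sum_list xs} \<and> length xs \<le> sum_list xs"
      using member_le_sum_list by fastforce
  qed
  then show "finite {xs \<in> {xs. strict_parts xs}. sum_list xs = n}"
    using finite_lists_length_le[of "{..n}" n] by (auto elim: finite_subset)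
qed

text \<open>For a nonempty list the bounded quantity is \<open>u_1 - s\<close>; for the empty list
  \<open>tl [] = []\<close> makes it 0.\<close>

definition alt_lists :: "nat \<Rightarrow> nat \<Rightarrow> nat list set" where
  "alt_lists s c = {xs. strict_parts xs \<and> altsum xs = s \<and> altsum (tl xs) \<le> c}"

lemma finite_fibers_alt_lists: "finite_fibers sum_list (alt_lists s c)"
  by (rule finite_fibers_subset[OF finite_fibers_strict_parts]) (auto simp: alt_lists_def)

lemma alt_lists_0: "alt_lists 0 c = {[]}"
  by (auto simp: alt_lists_def altsum_eq_0_iff)

text \<open>Deleting the first part turns \<open>u\<^sub>1 - s\<close> into the alternating sum; the condition that the
  remaining parts be smaller than \<open>u\<^sub>1\<close> becomes the bound \<open>s - 1\<close> on the new residue.\<close>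

lemma gf_alt_lists_exact:
  "gf sum_list {xs. strict_parts xs \<and> altsum xs = Suc s \<and> altsum (tl xs) = t} =
     fps_X ^ (Suc s + t) * gf sum_list (alt_lists t s)" (is "gf _ ?A = _")
proof (rule gf_bij)
  let ?f = "(#) (Suc s + t)"
  show "bij_betw ?f (alt_lists t s) ?A"
  proof (rule bij_betw_byWitness[where f' = tl])
    show "\<forall>xs\<in>?A. ?f (tl xs) = xs"
    proof clarify
      fix xs assume "strict_parts xs" "altsum xs = Suc s" "t = altsum (tl xs)"
      then show "(Suc s + altsum (tl xs)) # tl xs = xs"
        using hd_eq_altsum[of xs] by (cases xs) auto
    qed
    show "?f ` alt_lists t s \<subseteq> ?A"
    proof clarify
      fix xs assume "xs \<in> alt_lists t s"
      then show "strict_parts (?f xs) \<and> altsum (?f xs) = Suc s \<and> altsum (tl (?f xs)) = t"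
        using hd_eq_altsum[of xs] by (cases "xs = []") (auto simp: alt_lists_def strict_parts_Cons)
    qed
    show "tl ` ?A \<subseteq> alt_lists t s"
    proof clarify
      fix xs assume *: "strict_parts xs" "altsum xs = Suc s" "t = altsum (tl xs)"
      then obtain x ys where xs: "xs = x # ys"
        by (cases xs) auto
      \<comment> \<open>The head \<open>Suc s + altsum ys\<close> of \<open>xs\<close> must exceed
        the head \<open>altsum ys + altsum (tl ys)\<close> of \<open>ys\<close>.\<close>
      have "altsum (tl ys) \<le> s"
      proof (cases "ys = []")
        case False
        then have "altsum ys + altsum (tl ys) < Suc s + altsum ys"
          using * hd_eq_altsum[of ys] hd_eq_altsum[of xs] by (simp add: xs strict_parts_Cons)
        then show ?thesis by simp
      qed auto
      then show "tl xs \<in> alt_lists (altsum (tl xs)) s"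
        using * by (simp add: xs alt_lists_def strict_parts_Cons)
    qed
  qed auto
qed auto

text \<open>Split off the lists with \<open>altsum (tl xs) = c\<close>. Deleting their first part
  leads to the parameters \<open>c\<close> and \<open>s - 1\<close>, whose sum is smaller; symmetry
  of \<open>qbin\<close> then turns the two summands into the mirrored Pascal rule.\<close>

lemma gf_alt_lists: "gf sum_list (alt_lists s c) = fps_X ^ s * qbin (fps_X\<^sup>2) s c"
proof (induction "s + c" arbitrary: s c rule: less_induct)
  case less
  let ?E = "\<lambda>s t. {xs. strict_parts xs \<and> altsum xs = s \<and> altsum (tl xs) = t}"
  show ?case
  proof (cases s)
    case 0
    then show ?thesis
      by (simp add: alt_lists_0 gf_singleton)
  next
    case (Suc r)
    show ?thesis
    proof (cases c)
      case 0
      have "gf sum_list (alt_lists s c) = gf sum_list (?E (Suc r) 0)"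
        by (simp add: alt_lists_def Suc 0)
      also have "\<dots> = fps_X ^ s"
        unfolding gf_alt_lists_exact by (simp add: alt_lists_0 gf_singleton Suc)
      finally show ?thesis
        by (simp add: 0)
    next
      case (Suc d)
      have "alt_lists s c = alt_lists s d \<union> ?E (Suc r) c"
        by (auto simp: alt_lists_def Suc \<open>s = Suc r\<close>)
      moreover have "finite_fibers sum_list (?E (Suc r) c)"
        by (rule finite_fibers_subset[OF finite_fibers_strict_parts]) auto
      moreover have "alt_lists s d \<inter> ?E (Suc r) c = {}"
        by (auto simp: alt_lists_def Suc)
      ultimately have "gf sum_list (alt_lists s c) =
          gf sum_list (alt_lists s d) + gf sum_list (?E (Suc r) c)"
        by (simp add: gf_Un finite_fibers_alt_lists)
      also have "\<dots> = fps_X ^ s * qbin (fps_X\<^sup>2) s d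
          + fps_X ^ (s + c) * (fps_X ^ c * qbin (fps_X\<^sup>2) c r)"
        unfolding gf_alt_lists_exact using less[of s d] less[of c r]
        by (simp add: Suc \<open>s = Suc r\<close>)
      also have "qbin (fps_X\<^sup>2 :: rat fps) c r = qbin (fps_X\<^sup>2) r c"
        by (rule qbin_sym) (rule fps_X2_power_neq_1)
      also have "fps_X ^ s * qbin (fps_X\<^sup>2) s d + fps_X ^ (s + c) * (fps_X ^ c * qbin (fps_X\<^sup>2) r c)
          = fps_X ^ s * (qbin (fps_X\<^sup>2) s d + (fps_X\<^sup>2) ^ c * qbin (fps_X\<^sup>2 :: rat fps) r c)"
        by (simp add: algebra_simps power_add power2_eq_square power_mult_distrib)
      also have "qbin (fps_X\<^sup>2) s d + (fps_X\<^sup>2) ^ c * qbin (fps_X\<^sup>2 :: rat fps) r c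
          = qbin (fps_X\<^sup>2) s c"
        unfolding Suc \<open>s = Suc r\<close>
        by (rule qbin_Suc_Suc'[symmetric]) (rule fps_X2_power_neq_1)
      finally show ?thesis .
    qed
  qed
qed

section \<open>Multisets of pairs\<close>

definition bounded_parts :: "nat \<Rightarrow> nat \<Rightarrow> nat multiset set" where
  "bounded_parts r m = {P. set_mset P \<subseteq> {1..r} \<and> size P \<le> m}"

text \<open>The inserted 0 gives the empty multiset maximum 0, in agreement with
  \<open>largest_paired\<close>.\<close>

definition max_part :: "nat multiset \<Rightarrow> nat" where
  "max_part P = Max (insert 0 (set_mset P))"

definition max_parts :: "nat \<Rightarrow> nat \<Rightarrow> nat multiset set" where
  "max_parts r m = {P. 0 \<notin># P \<and> max_part P = r \<and> size P \<le> m}"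

abbreviation pair_weight :: "nat multiset \<Rightarrow> nat" where
  "pair_weight P \<equiv> 2 * sum_mset P"

lemma max_part_le_iff: "max_part P \<le> r \<longleftrightarrow> (\<forall>k\<in>#P. k \<le> r)"
  by (simp add: max_part_def)

lemma finite_fibers_pairs: "finite_fibers pair_weight {P. 0 \<notin># P}"
  unfolding finite_fibers_def
proof
  fix n
  show "finite {P \<in> {P. 0 \<notin># P}. pair_weight P = n}"
    by (rule finite_subset[OF _ finite_partitions_of[of "n div 2"]]) (auto simp: partitions_of_def)
qed

lemma finite_fibers_max_parts: "finite_fibers pair_weight (max_parts r m)"
  by (rule finite_fibers_subset[OF finite_fibers_pairs]) (auto simp: max_parts_def)

lemma finite_fibers_bounded_parts: "finite_fibers pair_weight (bounded_parts r m)"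
  by (rule finite_fibers_subset[OF finite_fibers_pairs]) (auto simp: bounded_parts_def)

lemma max_parts_eq_bounded_parts:
  "max_parts (Suc r) m = bounded_parts (Suc r) m - bounded_parts r m"
proof -
  have "P \<in> max_parts (Suc r) m \<longleftrightarrow> P \<in> bounded_parts (Suc r) m \<and> P \<notin> bounded_parts r m" for P
  proof -
    have "P \<in> bounded_parts k m \<longleftrightarrow> 0 \<notin># P \<and> max_part P \<le> k \<and> size P \<le> m" for k
      by (auto simp: bounded_parts_def max_part_le_iff subset_iff Suc_le_eq intro!: gr0I)
    then show ?thesis
      by (simp add: max_parts_def) linarith
  qed
  then show ?thesis by blast
qed

text \<open>Deleting one copy of the maximal part \<open>Suc r\<close> lowers the pair weight by
  \<open>2 * Suc r\<close> and leaves an arbitrary multiset with the same bound on parts and one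
  element fewer allowed.\<close>

lemma gf_max_parts_Suc:
  "gf pair_weight (max_parts (Suc r) (Suc m)) =
     (fps_X\<^sup>2) ^ Suc r * gf pair_weight (bounded_parts (Suc r) m)"
proof -
  have "bij_betw (add_mset (Suc r)) (bounded_parts (Suc r) m) (max_parts (Suc r) (Suc m))"
    unfolding max_parts_eq_bounded_parts
  proof (rule bij_betw_byWitness[where f' = "\<lambda>P. P - {#Suc r#}"])
    have mem: "Suc r \<in># P" if "P \<in> bounded_parts (Suc r) (Suc m) - bounded_parts r (Suc m)" for P
    proof (rule ccontr)
      assume "Suc r \<notin># P"
      then have "k \<noteq> Suc r" if "k \<in># P" for k
        using that by blast
      with that show False
        by (force simp: bounded_parts_def le_Suc_eq)
    qed
    show "\<forall>P\<in>bounded_parts (Suc r) (Suc m) - bounded_parts r (Suc m).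
        add_mset (Suc r) (P - {#Suc r#}) = P"
      using mem by simp
    show "(\<lambda>P. P - {#Suc r#}) ` (bounded_parts (Suc r) (Suc m) - bounded_parts r (Suc m))
        \<subseteq> bounded_parts (Suc r) m"
    proof clarify
      fix P assume P: "P \<in> bounded_parts (Suc r) (Suc m)" "P \<notin> bounded_parts r (Suc m)"
      have "Suc r \<in># P"
        using P mem by blast
      then obtain Q where "P = add_mset (Suc r) Q"
        by (metis insert_DiffM)
      then show "P - {#Suc r#} \<in> bounded_parts (Suc r) m"
        using P by (simp add: bounded_parts_def)
    qed
  qed (auto simp: bounded_parts_def)
  then have "gf pair_weight (max_parts (Suc r) (Suc m)) =
      (fps_X :: rat fps) ^ (2 * Suc r) * gf pair_weight (bounded_parts (Suc r) m)"
    by (rule gf_bij) simp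
  also have "fps_X ^ (2 * Suc r) = (fps_X\<^sup>2 :: rat fps) ^ Suc r"
    by (rule power_mult)
  finally show ?thesis .
qed

text \<open>Splitting by whether \<open>Suc r\<close> occurs reproduces the recursion that defines
  \<open>qbin\<close>.\<close>

lemma gf_bounded_parts: "gf pair_weight (bounded_parts r m) = qbin (fps_X\<^sup>2) r m"
proof (induction "fps_X\<^sup>2 :: rat fps" r m rule: qbin.induct)
  case (1 m)
  have "bounded_parts 0 m = {{#}}"
    by (auto simp: bounded_parts_def)
  then show ?case
    by (simp add: gf_singleton)
next
  case (2 r)
  have "bounded_parts (Suc r) 0 = {{#}}"
    by (auto simp: bounded_parts_def)
  then show ?case
    by (simp add: gf_singleton)
next
  case (3 r m)
  have "bounded_parts r (Suc m) \<subseteq> bounded_parts (Suc r) (Suc m)"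
    by (auto simp: bounded_parts_def)
  then have "bounded_parts (Suc r) (Suc m) = bounded_parts r (Suc m) \<union> max_parts (Suc r) (Suc m)"
    by (auto simp: max_parts_eq_bounded_parts)
  moreover have "bounded_parts r (Suc m) \<inter> max_parts (Suc r) (Suc m) = {}"
    by (auto simp: max_parts_eq_bounded_parts)
  ultimately have "gf pair_weight (bounded_parts (Suc r) (Suc m)) =
      gf pair_weight (bounded_parts r (Suc m)) + gf pair_weight (max_parts (Suc r) (Suc m))"
    by (simp add: gf_Un finite_fibers_bounded_parts finite_fibers_max_parts)
  then show ?case
    by (simp add: 3 gf_max_parts_Suc)
qed

lemma max_parts_0: "max_parts 0 m = {{#}}"
proof -
  have "P = {#}" if "0 \<notin># P" "max_part P = 0" for P
    using that max_part_le_iff[of P 0] by (metis le_zero_eq multiset_nonemptyE)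
  then show ?thesis
    by (auto simp: max_parts_def) (auto simp: max_part_def)
qed

lemma max_parts_Suc_0: "max_parts (Suc r) 0 = {}"
  by (auto simp: max_parts_def max_part_def)

text \<open>The mirrored Pascal rule times \<open>(fps_X\<^sup>2) ^ Suc r\<close>; in the second
  summand one factor \<open>fps_X\<^sup>2\<close> passes to the power that belongs to the size
  bound.\<close>

lemma gf_max_parts_step:
  "gf pair_weight (max_parts (Suc r) (Suc m)) = gf pair_weight (max_parts (Suc r) m)
     + fps_X ^ (2 * Suc m) * gf pair_weight (max_parts r (Suc m))"
proof -
  have eq: "gf pair_weight (max_parts (Suc r) (Suc m)) =
      (fps_X\<^sup>2) ^ Suc r * qbin (fps_X\<^sup>2) (Suc r) m" for r m
    by (simp only: gf_max_parts_Suc gf_bounded_parts)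
  have pow: "fps_X ^ (2 * Suc m) = (fps_X\<^sup>2 :: rat fps) ^ Suc m"
    by (simp only: power_mult)
  have pascal: "qbin (fps_X\<^sup>2 :: rat fps) (Suc r) (Suc m) =
      qbin (fps_X\<^sup>2) (Suc r) m + (fps_X\<^sup>2) ^ Suc m * qbin (fps_X\<^sup>2) r (Suc m)" for r m
    by (rule qbin_Suc_Suc') (rule fps_X2_power_neq_1)
  \<comment> \<open>The closed form \<open>eq\<close> covers only positive maximum and positive size
    bound, so zero values of \<open>m\<close> and \<open>r\<close> go through the explicit
    sets.\<close>
  show ?thesis
  proof (cases m)
    case 0
    show ?thesis
      unfolding 0 eq[of r 0] pow[unfolded 0]
      by (cases r) (simp_all add: max_parts_Suc_0 eq max_parts_0 gf_singleton)
  next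
    case (Suc k)
    show ?thesis
    proof (cases r)
      case 0
      show ?thesis
        unfolding 0 Suc eq pow[unfolded Suc] pascal
        by (simp add: max_parts_0 gf_singleton distrib_left del: qbin.simps(3))
    next
      case (Suc n)
      show ?thesis
        unfolding \<open>m = Suc k\<close> Suc eq pow[unfolded \<open>m = Suc k\<close>] pascal
        by (simp add: algebra_simps del: qbin.simps(3))
    qed
  qed
qed

section \<open>Splitting a partition into pairs and unpaired parts\<close>

definition assemble :: "nat multiset \<times> nat list \<Rightarrow> nat multiset" where
  "assemble = (\<lambda>(P, xs). P + P + mset xs)"

text \<open>A new part \<open>x\<close> forms a pair with an unpaired \<open>x\<close> if there is
  one, and otherwise becomes unpaired itself.\<close>

lemma exists_pairing: "\<exists>P U. finite U \<and> p = P + P + mset_set U"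
proof (induction p)
  case empty
  show ?case
    by (rule exI[of _ "{#}"], rule exI[of _ "{}"]) simp
next
  case (add x p)
  then obtain P U where PU: "finite U" "p = P + P + mset_set U"
    by blast
  show ?case
  proof (cases "x \<in> U")
    case True
    then have "mset_set U = add_mset x (mset_set (U - {x}))"
      using PU(1) by (simp add: mset_set.remove)
    then show ?thesis
      using PU by (intro exI[of _ "add_mset x P"] exI[of _ "U - {x}"]) simp
  next
    case False
    then show ?thesis
      using PU by (intro exI[of _ P] exI[of _ "insert x U"]) simp
  qed
qed

lemma exists_assemble:
  assumes "0 \<notin># p"
  obtains P xs where "0 \<notin># P" "strict_parts xs" "p = assemble (P, xs)"
proof -
  obtain P U where PU: "finite U" "p = P + P + mset_set U"
    using exists_pairing by blast
  have "sorted_wrt (>) (rev (sorted_list_of_set U))"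
    unfolding sorted_wrt_rev using strict_sorted_list_of_set by simp
  then have "strict_parts (rev (sorted_list_of_set U))"
    using PU assms by (simp add: strict_parts_def)
  moreover have "mset (rev (sorted_list_of_set U)) = mset_set U"
    using PU(1) by (metis distinct_rev distinct_sorted_list_of_set mset_set_set set_rev
        sorted_list_of_set.set_sorted_key_list_of_set)
  ultimately show ?thesis
    using that[of P "rev (sorted_list_of_set U)"] PU assms by (simp add: assemble_def)
qed

context
  fixes P :: "nat multiset" and xs :: "nat list"
  assumes P: "0 \<notin># P" and xs: "strict_parts xs"
begin

lemma distinct_strict_parts: "distinct xs"
  using xs unfolding strict_parts_def by (induction xs) auto

lemma count_strict_parts: "count (mset xs) k = (if k \<in> set xs then 1 else 0)"
  using distinct_strict_parts by (rule distinct_count_atmost_1[THEN iffD1, rule_format])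

lemma unpaired_sizes_assemble: "unpaired_sizes (assemble (P, xs)) = set xs"
  by (auto simp: unpaired_sizes_def assemble_def count_strict_parts)

lemma unpaired_list_assemble: "unpaired_list (assemble (P, xs)) = xs"
proof -
  have "sorted (rev xs)"
    using xs unfolding strict_parts_def sorted_wrt_rev
    by (auto elim: sorted_wrt_mono_rel[rotated])
  then have "sorted_list_of_set (set (rev xs)) = rev xs"
    using distinct_strict_parts by (intro sorted_list_of_set.idem_if_sorted_distinct) auto
  then show ?thesis
    by (simp add: unpaired_list_def unpaired_sizes_assemble)
qed

lemma pair_span_assemble: "pair_span (assemble (P, xs)) = 2 * size P"
  unfolding pair_span_def paired_parts_def unpaired_sizes_assemble
  using distinct_strict_parts by (simp add: assemble_def mset_set_set)

lemma largest_paired_assemble: "largest_paired (assemble (P, xs)) = max_part P"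
proof -
  \<comment> \<open>Sizes in \<open>P\<close> have multiplicity at least 2, while sizes occurring
    only in \<open>xs\<close> appear once.\<close>
  have "{k. count (assemble (P, xs)) k \<ge> 2} = set_mset P"
    by (auto simp: assemble_def count_strict_parts Suc_le_eq split: if_splits
        simp flip: count_greater_zero_iff)
  moreover from this have "(\<exists>k. count (assemble (P, xs)) k \<ge> 2) \<longleftrightarrow> P \<noteq> {#}"
    by (metis (mono_tags, lifting) ex_in_conv mem_Collect_eq set_mset_eq_empty_iff)
  ultimately show ?thesis
    by (simp add: largest_paired_def max_part_def)
qed

lemma pairing_index_assemble: "pairing_index (assemble (P, xs)) = int (max_part P + altsum xs)"
  by (simp add: pairing_index_def largest_paired_assemble unpaired_alternating_sum_def
      unpaired_list_assemble altsum_eq_sum[OF xs])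

lemma residual_span_assemble:
  "residual_span (assemble (P, xs)) = (if xs = [] then 0 else 2 * int (altsum (tl xs)) + 1)"
  using hd_eq_altsum[OF xs]
  by (simp add: residual_span_def unpaired_alternating_sum_def
      unpaired_list_assemble flip: altsum_eq_sum[OF xs])

text \<open>The bounds \<open>2 * size P \<le> b\<close> and \<open>2 * t + 1 \<le> b\<close> become
  floors, where \<open>b \<ge> 1\<close> keeps \<open>b - 1\<close> from truncating. For empty
  \<open>xs\<close> the residual span and the tail sum are both 0.\<close>

lemma pairing_width_assemble_le_iff:
  assumes "b \<ge> 1"
  shows "pairing_width (assemble (P, xs)) \<le> int b \<longleftrightarrow>
    size P \<le> b div 2 \<and> altsum (tl xs) \<le> (b - 1) div 2"
  using assms by (auto simp: pairing_width_def pair_span_assemble residual_span_assemble)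

lemma assemble_pos: "0 \<notin># assemble (P, xs)"
  using P xs by (simp add: assemble_def strict_parts_def)

lemma pairing_width_assemble_le_0_iff:
  "pairing_width (assemble (P, xs)) \<le> 0 \<longleftrightarrow> P = {#} \<and> xs = []"
  by (simp add: pairing_width_def pair_span_assemble residual_span_assemble)

end

text \<open>The unpaired list recovers \<open>xs\<close>; the multiplicities in \<open>P + P\<close>
  are then halved.\<close>

lemma assemble_inject:
  assumes "0 \<notin># P" "strict_parts xs" "0 \<notin># Q" "strict_parts ys"
    and eq: "assemble (P, xs) = assemble (Q, ys)"
  shows "P = Q \<and> xs = ys"
proof -
  have "xs = ys"
    using unpaired_list_assemble assms by metis
  with eq have "P + P = Q + Q"
    by (simp add: assemble_def)
  then have "count (P + P) k = count (Q + Q) k" for k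
    by simp
  then have "2 * count P k = 2 * count Q k" for k
    unfolding count_union mult_2 .
  then have "P = Q"
    by (simp add: multiset_eq_iff)
  with \<open>xs = ys\<close> show ?thesis by simp
qed

section \<open>Partitions of given index and bounded width\<close>

definition width_at_most :: "nat \<Rightarrow> nat \<Rightarrow> nat multiset set" where
  "width_at_most a b = {p. 0 \<notin># p \<and> pairing_index p = int a \<and> pairing_width p \<le> int b}"

lemma finite_fibers_width_at_most: "finite_fibers sum_mset (width_at_most a b)"
proof -
  have "finite_fibers sum_mset {p :: nat multiset. 0 \<notin># p}"
    using finite_partitions_of by (simp add: finite_fibers_def partitions_of_def)
  then show ?thesis
    by (rule finite_fibers_subset) (auto simp: width_at_most_def)
qed

text \<open>Any pair or unpaired part makes the width positive, so width 0 leaves only the empty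
  partition, whose index is 0.\<close>

lemma width_at_most_0: "a \<ge> 1 \<Longrightarrow> width_at_most a 0 = {}"
proof (rule equals0I)
  fix p assume "a \<ge> 1" and p: "p \<in> width_at_most a 0"
  have "0 \<notin># p"
    using p by (simp add: width_at_most_def)
  then obtain P xs where "0 \<notin># P" "strict_parts xs" "p = assemble (P, xs)"
    by (rule exists_assemble)
  with p \<open>a \<ge> 1\<close> show False
    by (auto simp: width_at_most_def pairing_index_assemble pairing_width_assemble_le_0_iff
        max_part_def)
qed

text \<open>By unique splitting, partitions correspond to pairs \<open>(P, xs)\<close>. The index is
  additive over the two components and the width bound restricts them independently.\<close>

lemma gf_width_at_most_convolution:
  assumes "b \<ge> 1"
  shows "gf sum_mset (width_at_most a b) =
    (\<Sum>s\<le>a. gf pair_weight (max_parts (a - s) (b div 2)) * gf sum_list (alt_lists s ((b - 1) div 2)))"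
proof -
  let ?S = "\<lambda>s. max_parts (a - s) (b div 2) \<times> alt_lists s ((b - 1) div 2)"
  let ?w = "\<lambda>(P, xs). pair_weight P + sum_list xs"
  have "bij_betw assemble (\<Union>s\<le>a. ?S s) (width_at_most a b)"
    unfolding bij_betw_def
  proof
    show "inj_on assemble (\<Union>s\<le>a. ?S s)"
      by (rule inj_onI) (auto simp: max_parts_def alt_lists_def dest: assemble_inject)
    show "assemble ` (\<Union>s\<le>a. ?S s) = width_at_most a b"
    proof
      show "assemble ` (\<Union>s\<le>a. ?S s) \<subseteq> width_at_most a b"
        using assms
        by (auto simp: width_at_most_def max_parts_def alt_lists_def assemble_pos
            pairing_index_assemble pairing_width_assemble_le_iff)
      show "width_at_most a b \<subseteq> assemble ` (\<Union>s\<le>a. ?S s)"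
      proof
        fix p assume p: "p \<in> width_at_most a b"
        then have "0 \<notin># p"
          by (simp add: width_at_most_def)
        then obtain P xs where *: "0 \<notin># P" "strict_parts xs" "p = assemble (P, xs)"
          by (rule exists_assemble)
        then have "altsum xs \<le> a" "(P, xs) \<in> ?S (altsum xs)"
          using p assms
          by (auto simp: width_at_most_def max_parts_def alt_lists_def
            pairing_index_assemble pairing_width_assemble_le_iff simp flip: of_nat_add)
        then show "p \<in> assemble ` (\<Union>s\<le>a. ?S s)"
          using *(3) by blast
      qed
    qed
  qed
  then have "gf sum_mset (width_at_most a b) = fps_X ^ 0 * gf ?w (\<Union>s\<le>a. ?S s)"
    by (rule gf_bij) (auto simp: assemble_def sum_mset_sum_list)
  also have "\<dots> = (\<Sum>s\<le>a. gf ?w (?S s))"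
  proof -
    have "finite_fibers ?w (?S s)" for s
      by (intro finite_fibers_Times finite_fibers_max_parts finite_fibers_alt_lists)
    moreover have "?S s \<inter> ?S t = {}" if "s \<noteq> t" for s t
      using that by (auto simp: alt_lists_def)
    ultimately show ?thesis
      by (simp add: gf_UN)
  qed
  also have "\<dots> = (\<Sum>s\<le>a. gf pair_weight (max_parts (a - s) (b div 2)) *
      gf sum_list (alt_lists s ((b - 1) div 2)))"
    by (simp add: gf_Times finite_fibers_max_parts finite_fibers_alt_lists)
  finally show ?thesis .
qed

section \<open>The recursion in the width\<close>

text \<open>The summand \<open>s = Suc a\<close> involves only \<open>f 0\<close>, where
  \<open>f\<close> and \<open>f'\<close> agree; the recursion applies in all others.\<close>

lemma convolution_step:
  fixes f f' g :: "nat \<Rightarrow> 'a::comm_ring_1"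
  assumes "f 0 = f' 0" and "\<And>r. f (Suc r) = f' (Suc r) + c * f r"
  shows "(\<Sum>s\<le>Suc a. f (Suc a - s) * g s) =
    (\<Sum>s\<le>Suc a. f' (Suc a - s) * g s) + c * (\<Sum>s\<le>a. f (a - s) * g s)"
proof -
  have "(\<Sum>s\<le>a. f (Suc a - s) * g s) = (\<Sum>s\<le>a. f' (Suc a - s) * g s + c * (f (a - s) * g s))"
    by (rule sum.cong) (auto simp: assms(2) Suc_diff_le algebra_simps)
  then show ?thesis
    by (simp add: assms(1) sum.distrib sum_distrib_left)
qed

lemma convolution_commute:
  fixes f g :: "nat \<Rightarrow> 'a::comm_ring_1"
  shows "(\<Sum>s\<le>a. f (a - s) * g s) = (\<Sum>s\<le>a. g (a - s) * f s)"
  by (rule sum.reindex_bij_witness[of _ "\<lambda>s. a - s" "\<lambda>s. a - s"]) (auto simp: mult.commute)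

text \<open>The mirrored Pascal rule again: one \<open>fps_X\<close> from
  \<open>fps_X ^ Suc s\<close> joins \<open>(fps_X\<^sup>2) ^ Suc c\<close>, whence the odd
  exponent.\<close>

lemma gf_alt_lists_step:
  "gf sum_list (alt_lists (Suc s) (Suc c)) = gf sum_list (alt_lists (Suc s) c)
     + fps_X ^ (2 * c + 3) * gf sum_list (alt_lists s (Suc c))"
proof -
  have pascal: "qbin (fps_X\<^sup>2 :: rat fps) (Suc s) (Suc c) =
      qbin (fps_X\<^sup>2) (Suc s) c + (fps_X\<^sup>2) ^ Suc c * qbin (fps_X\<^sup>2) s (Suc c)"
    by (rule qbin_Suc_Suc') (rule fps_X2_power_neq_1)
  have "(fps_X :: rat fps) ^ Suc s * (fps_X\<^sup>2) ^ Suc c = fps_X ^ (2 * c + 3) * fps_X ^ s"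
    by (simp flip: power_mult power_add power_Suc)
  then show ?thesis
    unfolding gf_alt_lists pascal distrib_left mult.assoc[symmetric] by simp
qed

lemma gf_width_at_most_step:
  "gf sum_mset (width_at_most (Suc a) (Suc (Suc b))) = gf sum_mset (width_at_most (Suc a) (Suc b))
     + fps_X ^ (Suc (Suc b)) * gf sum_mset (width_at_most a (Suc (Suc b)))"
proof -
  let ?f = "\<lambda>m r. gf pair_weight (max_parts r m)" and ?g = "\<lambda>c s. gf sum_list (alt_lists s c)"
  have conv: "gf sum_mset (width_at_most a (Suc b)) =
      (\<Sum>s\<le>a. ?f (Suc b div 2) (a - s) * ?g (b div 2) s)" for a b
    by (simp add: gf_width_at_most_convolution)
  \<comment> \<open>For \<open>b = 2 * m\<close> only the bound on pairs rises from \<open>m\<close>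
    to \<open>Suc m\<close>, and for \<open>b = 2 * m + 1\<close> only the bound on the tail sum.
    The exponents \<open>2 * m + 2\<close> and \<open>2 * m + 3\<close> both equal
    \<open>b + 2\<close>.\<close>
  show ?thesis
  proof (cases "even b")
    case True
    then obtain m where b: "b = 2 * m" by blast
    have "(\<Sum>s\<le>Suc a. ?f (Suc m) (Suc a - s) * ?g m s) = (\<Sum>s\<le>Suc a. ?f m (Suc a - s) * ?g m s)
        + fps_X ^ (2 * Suc m) * (\<Sum>s\<le>a. ?f (Suc m) (a - s) * ?g m s)"
      by (rule convolution_step) (simp add: max_parts_0, rule gf_max_parts_step)
    then show ?thesis
      unfolding conv by (simp add: b del: sum.atMost_Suc)
  next
    case False
    then obtain m where b: "b = 2 * m + 1" by (blast elim: oddE)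
    \<comment> \<open>The other factor changes here, so the convolution is used with its factors
      exchanged.\<close>
    have "(\<Sum>s\<le>Suc a. ?g (Suc m) (Suc a - s) * ?f (Suc m) s) =
        (\<Sum>s\<le>Suc a. ?g m (Suc a - s) * ?f (Suc m) s)
        + fps_X ^ (2 * m + 3) * (\<Sum>s\<le>a. ?g (Suc m) (a - s) * ?f (Suc m) s)"
      by (rule convolution_step) (simp add: alt_lists_0, rule gf_alt_lists_step)
    moreover have "Suc (Suc b) = 2 * m + 3" "Suc (Suc b) div 2 = Suc m" "Suc b div 2 = Suc m"
      "b div 2 = m"
      by (simp_all add: b)
    ultimately show ?thesis
      unfolding conv convolution_commute[of "?f _"] by (simp only:)
  qed
qed

lemma gf_width_at_most: "gf sum_mset (width_at_most a (Suc b)) = fps_X ^ a * qbin fps_X a b"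
proof (induction "fps_X :: rat fps" a b rule: qbin.induct)
  case (1 b)
  show ?case
    by (simp add: gf_width_at_most_convolution max_parts_0 alt_lists_0 gf_singleton)
next
  case (2 a)
  \<comment> \<open>Width at most 1 leaves no room for pairs; only \<open>s = Suc a\<close>
    survives, giving the single part \<open>Suc a\<close>.\<close>
  have "gf pair_weight (max_parts (Suc a - s) 0) = 0" if "s \<le> a" for s
    using that by (simp add: Suc_diff_le max_parts_Suc_0)
  then show ?case
    by (simp add: gf_width_at_most_convolution max_parts_0 gf_singleton gf_alt_lists)
next
  case (3 a b)
  show ?case
    unfolding gf_width_at_most_step 3 qbin_fps_X_Suc_Suc'
    by (simp add: algebra_simps)
qed

section \<open>From bounded width to exact width\<close>

theorem mainTheorem4:
  fixes a b :: nat
  assumes "a \<ge> 1" and "b \<ge> 1"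
  shows "Abs_fps (\<lambda>n. of_nat (pairing_count a b n)) =
           fps_X ^ (a + b - 1) * gauss_binomial (a + b - 2) (a - 1)"
proof -
  obtain i j where ij: "a = Suc i" "b = Suc j"
    using assms by (metis Suc_le_D One_nat_def)
  let ?N = "{p. 0 \<notin># p \<and> pairing_index p = int a \<and> pairing_width p = int b}"
  have "Abs_fps (\<lambda>n. of_nat (pairing_count a b n)) = gf sum_mset ?N"
    by (simp add: gf_def pairing_count_def partitions_of_def conj_ac)
  moreover have "gf sum_mset (width_at_most a b) = gf sum_mset (width_at_most a j) + gf sum_mset ?N"
  proof -
    have "width_at_most a b = width_at_most a j \<union> ?N"
      by (auto simp: width_at_most_def ij)
    moreover have "finite_fibers sum_mset ?N"
      by (rule finite_fibers_subset[OF finite_fibers_width_at_most[of a b]])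
        (auto simp: width_at_most_def)
    moreover have "width_at_most a j \<inter> ?N = {}"
      by (auto simp: width_at_most_def ij)
    ultimately show ?thesis
      by (simp add: gf_Un finite_fibers_width_at_most)
  qed
  \<comment> \<open>The width recursion starts at bound 2, so \<open>j = 0\<close> is settled by the
    emptiness of \<open>width_at_most a 0\<close>.\<close>
  moreover have "gf sum_mset (width_at_most a b) =
      gf sum_mset (width_at_most a j) + fps_X ^ (i + b) * qbin fps_X i j"
  proof (cases j)
    case 0
    then show ?thesis
      using width_at_most_0[OF assms(1)] gf_width_at_most[of a 0] by (simp add: ij)
  next
    case (Suc k)
    show ?thesis
      unfolding ij Suc gf_width_at_most_step
      using gf_width_at_most[of i "Suc k"] by (simp add: power_add ac_simps)
  qed
  moreover have "gauss_binomial (a + b - 2) (a - 1) = qbin fps_X i j"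
    by (simp add: ij gauss_binomial_eq_qbin)
  ultimately show ?thesis
    by (simp add: ij)
qed

end
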